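(* Let $a\in\mathbb{Z}$ with $a\le-7$, let $f_a=(x-a)(x-a-1)-1$, $g_a=f_a+x-a-1$ and $h_a=f_a+x-a-2$, and let $\mathcal{R}=\{0,1,\ldots,|f_a(0)g_a(0)h_a(0)|-1\}$. Then $f_a,g_a,h_a$ are irreducible and pairwise coprime, and together with $\mathcal{R}$ they define a simultaneous digit system (over $\mathbb{Z}$) that has the Finite Expansion Property.
   Context: For $f_1,\ldots,f_k\in\mathbb{Z}[x]$ pairwise coprime with $f_1(0),\ldots,f_k(0)$ pairwise coprime, and $\mathcal{R}\subseteq\mathbb{Z}[x]$ a set whose constant coefficients form a complete residue system modulo $f_1(0)\cdots f_k(0)$, the simultaneous digit system is $(V,\phi,N)$ with $V=\prod_i\mathbb{Z}[x]/(f_i)$, $\phi$ componentwise multiplication by the residue class $X$ of $x$, and $N=\{(c,\ldots,c)\mid c\in\mathcal{R}\}$. It has the Finite Expansion Property if every $v\in V$ equals $\sum_{i=0}^\ell\phi^i(d_i)$ with $d_i\in N$. *)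

theory Defs
  imports
    "HOL-Algebra.Algebraic_Closure_Type"
    "HOL-Algebra.Chinese_Remainder"
    "HOL-Number_Theory.Cong"
begin

definition Zx :: "int poly ring" where
  "Zx = ring_of_type_algebra"

definition residue_class :: "int poly \<Rightarrow> int poly \<Rightarrow> int poly set" where
  "residue_class f p = (PIdl\<^bsub>Zx\<^esub> f) +>\<^bsub>Zx\<^esub> p"

definition quotient_Zx :: "int poly \<Rightarrow> int poly set ring" where
  "quotient_Zx f = Zx Quot (PIdl\<^bsub>Zx\<^esub> f)"

text \<open>
  The triple \<open>(V, \<phi>, N)\<close> of a simultaneous digit system consists of \<open>sds_space\<close>, \<open>sds_map\<close> and
  \<open>sds_digits\<close>. The elements of the product over the list \<open>fs\<close> are the lists \<open>v\<close>
  of the same length with \<open>v ! i\<close> a residue class modulo \<open>fs ! i\<close>.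
\<close>

definition sds_space :: "int poly list \<Rightarrow> int poly set list ring" where
  "sds_space fs = RDirProd_list (map quotient_Zx fs)"

definition sds_map :: "int poly list \<Rightarrow> int poly set list \<Rightarrow> int poly set list" where
  "sds_map fs v =
     map2 (\<lambda>f w. residue_class f [:0, 1:] \<otimes>\<^bsub>quotient_Zx f\<^esub> w) fs v"

definition sds_digits :: "int poly list \<Rightarrow> int poly set \<Rightarrow> int poly set list set" where
  "sds_digits fs R = (\<lambda>c. map (\<lambda>f. residue_class f c) fs) ` R"

text \<open>
  Every residue class is represented by the constant coefficient of exactly one element of
  \<open>R\<close>; in particular distinct elements of \<open>R\<close> have incongruent constant coefficients.
\<close>

definition constant_coeffs_complete_residue_system :: "int poly set \<Rightarrow> int \<Rightarrow> bool" where
  "constant_coeffs_complete_residue_system R m \<longleftrightarrow>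
     (\<forall>z. \<exists>!c. c \<in> R \<and> [Polynomial.coeff c 0 = z] (mod m))"

text \<open>
  \<open>coprime\<close> on \<open>int poly\<close> means that every common divisor in \<open>\<int>[x]\<close> is a unit, i.e. \<open>1\<close> or
  \<open>-1\<close>; it does not ask the generated ideal to be all of \<open>\<int>[x]\<close>. As \<open>coprime\<close> is symmetric,
  \<open>sorted_wrt coprime\<close> is coprimality of the entries at any two distinct positions.
\<close>

definition simultaneous_digit_system :: "int poly list \<Rightarrow> int poly set \<Rightarrow> bool" where
  "simultaneous_digit_system fs R \<longleftrightarrow>
     sorted_wrt coprime fs \<and>
     sorted_wrt coprime (map (\<lambda>f. poly f 0) fs) \<and>
     constant_coeffs_complete_residue_system R (\<Prod>f\<leftarrow>fs. poly f 0)"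

definition finite_expansion_property ::
    "('v, 'm) ring_scheme \<Rightarrow> ('v \<Rightarrow> 'v) \<Rightarrow> 'v set \<Rightarrow> bool" where
  "finite_expansion_property V \<phi> N \<longleftrightarrow>
     (\<forall>v \<in> carrier V. \<exists>l (d :: nat \<Rightarrow> 'v).
        (\<forall>i\<le>l. d i \<in> N) \<and> v = (\<Oplus>\<^bsub>V\<^esub> i \<in> {..l}. (\<phi> ^^ i) (d i)))"

definition f_poly :: "int \<Rightarrow> int poly" where
  "f_poly a = ([:0, 1:] - [:a:]) * ([:0, 1:] - [:a:] - 1) - 1"

definition g_poly :: "int \<Rightarrow> int poly" where
  "g_poly a = f_poly a + [:0, 1:] - [:a:] - 1"

definition h_poly :: "int \<Rightarrow> int poly" where
  "h_poly a = f_poly a + [:0, 1:] - [:a:] - 2"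

definition digit_polys :: "int \<Rightarrow> int poly set" where
  "digit_polys a =
     (\<lambda>c. [:c:]) ` {0..\<bar>poly (f_poly a) 0 * poly (g_poly a) 0 * poly (h_poly a) 0\<bar> - 1}"

end

theory Submission
  imports Defs "HOL-Computational_Algebra.Polynomial_Factorial"
begin

text \<open>
  In terms of \<open>y = x - a\<close> the three polynomials are \<open>y^2 - y - 1\<close>, \<open>y^2 - 2\<close> and \<open>y^2 - 3\<close>. They
  generate pairwise comaximal ideals of \<open>\<int>[x]\<close>, so \<open>V\<close> is \<open>\<int>[x]/(F)\<close> for their product \<open>F\<close>, and for
  \<open>a \<le> -7\<close> the coefficients of \<open>F\<close> do not increase with the degree. Kovacs' argument then applies:
  modulo \<open>(x - 1) F\<close> the constant \<open>F(0)\<close> equals \<open>x\<close> times a polynomial with nonnegative coefficients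
  that sum to \<open>F(0)\<close>. Dividing a polynomial with nonnegative coefficients by \<open>x\<close>, with a digit as
  remainder, therefore never increases the sum of its coefficients and lowers it by every nonzero
  digit. Eventually all digits vanish, and as there are only finitely many candidates for the
  remaining polynomial \<open>B\<close>, it satisfies \<open>F dvd (x^m - 1) * B\<close> for some \<open>m > 0\<close>. The irreducible
  factors of \<open>F\<close> have constant coefficients other than \<open>1\<close> and \<open>-1\<close>, hence are coprime to
  \<open>x^m - 1\<close>, and \<open>F dvd B\<close>.
\<close>

section \<open>Division with remainder by nonincreasing polynomials\<close>

text \<open>Write \<open>F = F(0) + x * F'\<close>. Then \<open>F(0)\<close> is congruent to
  \<open>x * (F - F')\<close> modulo \<open>F\<close>. The plainer choice \<open>- x * F'\<close>
  would bring in negative coefficients; \<open>F - F'\<close> has as coefficients the differences of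
  neighbouring coefficients of \<open>F\<close>.\<close>

definition carry_step :: "int poly \<Rightarrow> int poly \<Rightarrow> int poly" where
  "carry_step F A =
     poly_shift (Suc 0) A + smult (coeff A 0 div coeff F 0) (F - poly_shift (Suc 0) F)"

lemma pCons_coeff_0_poly_shift: "pCons (coeff p 0) (poly_shift (Suc 0) p) = p"
  by (rule poly_eqI) (simp add: coeff_pCons coeff_poly_shift split: nat.split)

text \<open>The difference is \<open>k * (1 - x) * F\<close>, with \<open>k\<close> the integer
  quotient of the constant coefficients.\<close>

lemma carry_step_dvd:
  "F dvd A - [:coeff A 0 mod coeff F 0:] - pCons 0 (carry_step F A)"
proof -
  define A' F' k where "A' = poly_shift (Suc 0) A" and "F' = poly_shift (Suc 0) F"
    and "k = coeff A 0 div coeff F 0"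
  have A: "A = pCons (coeff A 0) A'" and F: "F = pCons (coeff F 0) F'"
    by (simp_all add: pCons_coeff_0_poly_shift A'_def F'_def)
  have "A - [:coeff A 0 mod coeff F 0:] - pCons 0 (carry_step F A) =
      pCons (coeff A 0 - coeff A 0 mod coeff F 0) (smult k F' - smult k F)"
    by (subst (1) A) (simp add: carry_step_def k_def smult_diff_right flip: A'_def F'_def)
  also have "\<dots> = smult k (pCons (coeff F 0) F') - pCons 0 (smult k F)"
    by (simp add: k_def minus_mod_eq_div_mult)
  also have "\<dots> = F * (smult k (1 - [:0, 1:]))"
    by (simp add: algebra_simps smult_diff_right flip: F)
  finally show ?thesis
    by (rule dvdI)
qed

lemma poly_1_poly_shift: "poly (poly_shift (Suc 0) p) 1 = poly p 1 - coeff p (0::nat)" for p :: "int poly"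
  using arg_cong[OF pCons_coeff_0_poly_shift[of p], of "\<lambda>q. poly q 1"] by simp

text \<open>The value at 1 is the sum of the coefficients. For
  \<open>F - poly_shift (Suc 0) F\<close> it telescopes to \<open>coeff F 0\<close>, so the carry
  preserves the sum and only the digit is lost.\<close>

lemma poly_1_carry_step:
  "poly (carry_step F A) 1 = poly A 1 - coeff A 0 mod coeff F 0"
  by (simp add: carry_step_def poly_1_poly_shift minus_mod_eq_div_mult[symmetric] algebra_simps)

lemma degree_poly_shift_le: "degree (poly_shift n p) \<le> degree p"
  by (rule degree_le) (simp add: coeff_poly_shift coeff_eq_0)

lemma degree_carry_step_le: "degree (carry_step F A) \<le> max (degree A) (degree F)"
  unfolding carry_step_def
  by (intro degree_add_le max.coboundedI1[OF degree_poly_shift_le] max.coboundedI2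
      order.trans[OF degree_smult_le] degree_diff_le degree_poly_shift_le order.refl)

lemma antimono_coeff_nonneg:
  fixes F :: "int poly"
  assumes "antimono (coeff F)"
  shows "0 \<le> coeff F i"
proof -
  \<comment> \<open>The larger index lies beyond the degree, where the coefficient is 0.\<close>
  have "coeff F (i + Suc (degree F)) \<le> coeff F i"
    using assms by (rule antimonoD) simp
  then show ?thesis
    by (simp add: coeff_eq_0)
qed

lemma coeff_carry_step_nonneg:
  assumes "antimono (coeff F)" "\<And>i. 0 \<le> coeff A i"
  shows "0 \<le> coeff (carry_step F A) i"
proof -
  have "coeff F (Suc i) \<le> coeff F i"
    using assms(1) by (rule antimonoD) simp
  then show ?thesis
    using assms(2) antimono_coeff_nonneg[OF assms(1), of 0]
    by (simp add: carry_step_def coeff_poly_shift pos_imp_zdiv_nonneg_iff div_int_pos_iff)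
qed

section \<open>Finiteness of the set of polynomials with bounded degree and coefficients\<close>

lemma coeff_le_poly_1:
  fixes p :: "int poly"
  assumes "\<And>i. 0 \<le> coeff p i"
  shows "coeff p i \<le> poly p 1"
proof (cases "i \<le> degree p")
  case True
  then have "coeff p i \<le> (\<Sum>j\<le>degree p. coeff p j)"
    using assms by (intro member_le_sum) auto
  then show ?thesis
    by (simp add: poly_altdef)
next
  case False
  then show ?thesis
    using assms by (simp add: coeff_eq_0 poly_altdef sum_nonneg)
qed

lemma finite_bounded_polys:
  "finite {p :: int poly. degree p \<le> d \<and> (\<forall>i. coeff p i \<in> {0..s})}"
proof (rule finite_subset)
  show "{p. degree p \<le> d \<and> (\<forall>i. coeff p i \<in> {0..s})} \<subseteq>
      Poly ` {xs. set xs \<subseteq> {0..s} \<and> length xs \<le> Suc d}"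
  proof
    fix p :: "int poly"
    assume p: "p \<in> {p. degree p \<le> d \<and> (\<forall>i. coeff p i \<in> {0..s})}"
    then have "set (coeffs p) \<subseteq> {0..s}" "length (coeffs p) \<le> Suc d"
      by (auto simp: coeffs_def)
    then show "p \<in> Poly ` {xs. set xs \<subseteq> {0..s} \<and> length xs \<le> Suc d}"
      by (intro image_eqI[of _ _ "coeffs p"]) auto
  qed
  show "finite (Poly ` {xs. set xs \<subseteq> {0..s} \<and> length xs \<le> Suc d})"
    by (intro finite_imageI finite_lists_length_le) simp
qed

text \<open>Telescoping: \<open>carry_step_dvd\<close> for the \<open>i\<close>-th iterate is
  multiplied by \<open>x^i\<close>, and the results are added up. The last term is the part of
  \<open>A\<close> still to be expanded after \<open>n\<close> digits.\<close>

lemma funpow_carry_step_dvd: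
  "F dvd A - (\<Sum>i<n. monom (coeff ((carry_step F ^^ i) A) 0 mod coeff F 0) i)
     - monom 1 n * (carry_step F ^^ n) A"
proof (induction n)
  case 0
  then show ?case by simp
next
  case (Suc n)
  let ?B = "(carry_step F ^^ n) A"
  have "F dvd monom 1 n * (?B - [:coeff ?B 0 mod coeff F 0:] - pCons 0 (carry_step F ?B))"
    using carry_step_dvd by (rule dvd_mult)
  moreover have "monom 1 n * [:coeff ?B 0 mod coeff F 0:] = monom (coeff ?B 0 mod coeff F 0) n"
    by (simp add: mult_monom flip: monom_0)
  moreover have "monom 1 n * pCons 0 (carry_step F ?B) = monom 1 (Suc n) * carry_step F ?B"
    by (simp add: monom_Suc)
  ultimately have "F dvd monom 1 n * ?B - monom (coeff ?B 0 mod coeff F 0) n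
      - monom 1 (Suc n) * carry_step F ?B"
    by (simp add: right_diff_distrib)
  from dvd_add[OF Suc this] show ?case
    by (simp add: algebra_simps)
qed

lemma nonneg_expansion:
  fixes F A :: "int poly"
  assumes F: "antimono (coeff F)" and F0: "0 < coeff F 0"
    and cop: "\<And>m. 0 < m \<Longrightarrow> coprime F (monom 1 m - 1)"
    and A: "\<And>i. 0 \<le> coeff A i"
  shows "\<exists>l c. (\<forall>i. c i \<in> {0..<coeff F 0}) \<and> F dvd A - (\<Sum>i\<le>l. monom (c i) i)"
proof -
  define B where "B n = (carry_step F ^^ n) A" for n
  define s where "s n = poly (B n) 1" for n
  have B_Suc: "B (Suc n) = carry_step F (B n)" for n
    by (simp add: B_def)
  have B_nonneg: "0 \<le> coeff (B n) i" for n i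
    by (induction n arbitrary: i) (simp_all add: B_def A coeff_carry_step_nonneg[OF F])
  have s_nonneg: "0 \<le> s n" for n
    using coeff_le_poly_1[of "B n" 0, OF B_nonneg] B_nonneg[of n 0] by (simp add: s_def)
  have s_Suc: "s (Suc n) = s n - coeff (B n) 0 mod coeff F 0" for n
    by (simp add: s_def B_Suc poly_1_carry_step)
  have s_decseq: "decseq s"
    by (rule decseq_SucI) (simp add: s_Suc F0)
  \<comment> \<open>\<open>s\<close> attains its minimum at \<open>N\<close>; being nonincreasing,
    it is constant from there on, so all later digits vanish.\<close>
  obtain N where "\<And>n. nat (s N) \<le> nat (s n)"
    using ex_has_least_nat[of "\<lambda>_. True" 0 "\<lambda>n. nat (s n)"] by auto
  then have s_min: "s N \<le> s n" for n
    using s_nonneg[of n] nat_le_eq_zle[of "s n" "s N"] by (metis nat_le_eq_zle order.trans linear)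
  have s_const: "s (N + k) = s N" for k
    using s_min[of "N + k"] s_decseq by (simp add: antisym decseqD)
  have digit_0: "coeff (B (N + k)) 0 mod coeff F 0 = 0" for k
    using s_Suc[of "N + k"] s_const[of k] s_const[of "Suc k"] by simp
  have B_degree: "degree (B n) \<le> max (degree A) (degree F)" for n
  proof (induction n)
    case (Suc n)
    then show ?case
      using degree_carry_step_le[of F "B n"] by (simp add: B_Suc)
  qed (simp add: B_def)
  have coeff_le_s: "coeff (B (N + k)) i \<le> s N" for k i
    using coeff_le_poly_1[OF B_nonneg, of "N + k" i] s_const[of k] by (simp add: s_def)
  have "range (\<lambda>k. B (N + k)) \<subseteq>
      {p. degree p \<le> max (degree A) (degree F) \<and> (\<forall>i. coeff p i \<in> {0..s N})}"
    using B_degree B_nonneg coeff_le_s by auto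
  then have "finite (range (\<lambda>k. B (N + k)))"
    using finite_bounded_polys finite_subset by blast
  then have "\<not> inj (\<lambda>k. B (N + k))"
    using finite_imageD infinite_UNIV_nat by blast
  then obtain i j where "i < j" and Bij: "B (N + i) = B (N + j)"
    by (metis injI nat_neq_iff)
  define m where "m = j - i"
  have m: "0 < m" "N + j = N + i + m"
    using \<open>i < j\<close> by (simp_all add: m_def)
  have B_add: "(carry_step F ^^ k) (B n) = B (n + k)" for n k
    unfolding B_def add.commute[of n k] funpow_add by simp
  \<comment> \<open>Over one period from \<open>N + i\<close> to \<open>N + j\<close> all digits are
    0, so the digit sum drops out of the telescoped divisibility.\<close>
  have "F dvd B (N + i) - monom 1 m * (carry_step F ^^ m) (B (N + i))"
    using funpow_carry_step_dvd[of F "B (N + i)" m] by (simp add: B_add add.assoc digit_0)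
  also have "(carry_step F ^^ m) (B (N + i)) = B (N + j)"
    by (simp add: B_add m(2))
  finally have "F dvd - ((monom 1 m - 1) * B (N + j))"
    by (simp add: Bij algebra_simps)
  then have "F dvd (monom 1 m - 1) * B (N + j)"
    by (simp only: dvd_minus_iff)
  then have "F dvd B (N + j)"
    using cop[OF m(1)] by (simp add: coprime_dvd_mult_right_iff)
  \<comment> \<open>The unexpanded remainder after \<open>N + j\<close> digits is a multiple of
    \<open>F\<close>, so these digits already form an expansion of \<open>A\<close>.\<close>
  then have "F dvd monom 1 (N + j) * B (N + j)"
    by (rule dvd_mult)
  from dvd_add[OF funpow_carry_step_dvd[of F A "N + j"] this[unfolded B_def]]
  have "F dvd A - (\<Sum>i<N + j. monom (coeff (B i) 0 mod coeff F 0) i)"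
    by (simp add: B_def)
  \<comment> \<open>\<open>N + j\<close> is positive because \<open>i < j\<close>, so subtracting 1
    is not truncated.\<close>
  moreover have "{..<N + j} = {..N + j - 1}"
    using \<open>i < j\<close> by auto
  ultimately show ?thesis
    using F0 by (intro exI[of _ "N + j - 1"] exI[of _ "\<lambda>i. coeff (B i) 0 mod coeff F 0"]) simp
qed

text \<open>Coefficients are repaired one at a time: the multiple for the tail is shifted by
  \<open>x\<close>, and adding \<open>\<bar>a\<bar> * F\<close> makes the new constant coefficient
  nonnegative, since \<open>F(0)\<close> is at least 1, without lowering the others.\<close>

lemma ex_nonneg_representative:
  fixes F A :: "int poly"
  assumes F: "antimono (coeff F)" and F0: "0 < coeff F 0"
  shows "\<exists>G. F dvd G \<and> (\<forall>i. 0 \<le> coeff (A + G) i)"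
proof (induction A)
  case 0
  then show ?case by (intro exI[of _ 0]) simp
next
  case (pCons a A)
  then obtain G where G: "F dvd G" "\<And>i. 0 \<le> coeff (A + G) i"
    by blast
  have a: "0 \<le> a + \<bar>a\<bar> * coeff F 0"
  proof -
    have "\<bar>a\<bar> * 1 \<le> \<bar>a\<bar> * coeff F 0"
      using F0 by (intro mult_left_mono) auto
    then show ?thesis by linarith
  qed
  have "0 \<le> coeff (pCons a A + (pCons 0 G + smult \<bar>a\<bar> F)) i" for i
  proof (cases i)
    case (Suc j)
    have "0 \<le> coeff (A + G) j + \<bar>a\<bar> * coeff F (Suc j)"
      using G(2) antimono_coeff_nonneg[OF F] by (intro add_nonneg_nonneg mult_nonneg_nonneg) auto
    then show ?thesis
      by (simp add: Suc)
  qed (simp add: a)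
  moreover have "F dvd pCons 0 G + smult \<bar>a\<bar> F"
    using dvd_mult[OF G(1), of "[:0, 1:]"] by (intro dvd_add dvd_smult) simp_all
  ultimately show ?case
    by blast
qed

theorem expansion_if_antimono_coeff:
  fixes F A :: "int poly"
  assumes F: "antimono (coeff F)" "0 < coeff F 0"
    and cop: "\<And>m. 0 < m \<Longrightarrow> coprime F (monom 1 m - 1)"
  shows "\<exists>l c. (\<forall>i. c i \<in> {0..<coeff F 0}) \<and> F dvd A - (\<Sum>i\<le>l. monom (c i) i)"
proof -
  obtain G where G: "F dvd G" "\<And>i. 0 \<le> coeff (A + G) i"
    using ex_nonneg_representative[OF F] by blast
  obtain l c where lc: "\<And>i. c i \<in> {0..<coeff F 0}" "F dvd A + G - (\<Sum>i\<le>l. monom (c i) i)"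
    using nonneg_expansion[OF F cop G(2)] by blast
  have "F dvd A - (\<Sum>i\<le>l. monom (c i) i)"
    using dvd_diff[OF lc(2) G(1)] by (simp add: algebra_simps)
  with lc(1) show ?thesis
    by blast
qed

text \<open>As \<open>f\<close> is prime, it would otherwise divide \<open>x^m - 1\<close>, and
  evaluation at 0 would make \<open>f(0)\<close> a divisor of -1.\<close>

lemma irreducible_coprime_monom_minus_1:
  fixes f :: "int poly"
  assumes "irreducible f" and "1 < \<bar>poly f 0\<bar>" and "0 < m"
  shows "coprime f (monom 1 m - 1)"
proof (rule prime_elem_imp_coprime)
  show "prime_elem f"
    using assms(1) by (rule irreducible_imp_prime_elem)
  show "\<not> f dvd monom 1 m - 1"
  proof
    assume "f dvd monom 1 m - 1"
    then have "poly f 0 dvd poly (monom 1 m - 1) 0"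
      by (metis dvd_def poly_mult)
    then show False
      using assms(2,3) by (simp add: poly_monom power_0_left)
  qed
qed

section \<open>Simultaneous digit systems\<close>

text \<open>The canonical map from \<open>\<int>[x]\<close> to \<open>V\<close>. It maps
  \<open>R\<close> onto the digit set and turns multiplication by \<open>x\<close> into
  \<open>sds_map\<close>, so expansions can be computed in \<open>\<int>[x]\<close>.\<close>

definition residue_classes :: "int poly list \<Rightarrow> int poly \<Rightarrow> int poly set list" where
  "residue_classes fs p = map (\<lambda>f. residue_class f p) fs"

lemma Zx_simps [simp]:
  "carrier Zx = UNIV" "monoid.mult Zx = (*)" "one Zx = 1" "zero Zx = 0" "add Zx = (+)"
  by (simp_all add: Zx_def ring_of_type_algebra_def)

interpretation Zx: cring Zx
  unfolding Zx_def by (rule cring_from_type_algebra)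

lemma ideal_PIdl_Zx: "ideal (PIdl\<^bsub>Zx\<^esub> f) Zx"
  by (rule Zx.cgenideal_ideal) simp

lemma ring_quotient_Zx: "ring (quotient_Zx f)"
  unfolding quotient_Zx_def by (rule ideal.quotient_is_ring[OF ideal_PIdl_Zx])

lemma residue_class_ring_hom: "residue_class f \<in> ring_hom Zx (quotient_Zx f)"
proof -
  have "residue_class f = a_r_coset Zx (PIdl\<^bsub>Zx\<^esub> f)"
    by (simp add: residue_class_def fun_eq_iff)
  then show ?thesis
    unfolding quotient_Zx_def using ideal.rcos_ring_hom[OF ideal_PIdl_Zx] by simp
qed

lemma residue_class_eqI:
  assumes "f dvd p - q"
  shows "residue_class f p = residue_class f q"
proof -
  obtain k where "p - q = f * k"
    using assms by (rule dvdE)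
  then have k: "p = f * k + q"
    by (simp add: algebra_simps)
  have "\<ominus>\<^bsub>Zx\<^esub> q = - q"
    by (rule Zx.minus_equality) simp_all
  then have "p \<ominus>\<^bsub>Zx\<^esub> q = k * f"
    by (simp add: a_minus_def k mult.commute)
  then have "p \<ominus>\<^bsub>Zx\<^esub> q \<in> PIdl\<^bsub>Zx\<^esub> f"
    by (auto simp: cgenideal_def)
  then show ?thesis
    using Zx.quotient_eq_iff_same_a_r_cos[OF ideal_PIdl_Zx, of p q f] by (simp add: residue_class_def)
qed

lemma ring_sds_space: "ring (sds_space fs)"
  unfolding sds_space_def by (rule RDirProd_list_is_ring) (simp add: ring_quotient_Zx)

lemma residue_classes_ring_hom: "residue_classes fs \<in> ring_hom Zx (sds_space fs)"
proof (induction fs)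
  case Nil
  show ?case
    by (rule ring_hom_memI) (simp_all add: residue_classes_def sds_space_def monoid.defs)
next
  case (Cons f fs)
  \<comment> \<open>The list product is an iterated binary product, so the map factors through the
    diagonal, a pair of homomorphisms and consing.\<close>
  have "residue_classes (f # fs) =
      (\<lambda>(a, as). a # as) \<circ> ((\<lambda>(r, s). (residue_class f r, residue_classes fs s)) \<circ> (\<lambda>a. (a, a)))"
    by (simp add: residue_classes_def fun_eq_iff)
  also have "\<dots> \<in> ring_hom Zx (sds_space (f # fs))"
    using Cons unfolding sds_space_def list.map
    by (intro ring_hom_trans[OF ring_hom_trans[OF RDirProd_hom1
          RDirProd_hom3[OF residue_class_ring_hom]] RDirProd_list_hom1])
  finally show ?case .
qed

section \<open>Transfer of digit expansions from polynomials to the product ring\<close>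

lemma sds_map_residue_classes:
  "sds_map fs (residue_classes fs p) = residue_classes fs ([:0, 1:] * p)"
proof -
  have "residue_class f ([:0, 1:] * p) =
      residue_class f [:0, 1:] \<otimes>\<^bsub>quotient_Zx f\<^esub> residue_class f p" for f
    using ring_hom_mult[OF residue_class_ring_hom, of "[:0, 1:]" p f] by simp
  then show ?thesis
    by (induction fs) (simp_all add: sds_map_def residue_classes_def del: mult_pCons_left)
qed

lemma funpow_sds_map_residue_classes:
  "(sds_map fs ^^ i) (residue_classes fs p) = residue_classes fs (monom 1 i * p)"
  by (induction i) (simp_all add: sds_map_residue_classes monom_Suc)

lemma finsum_residue_classes:
  fixes l :: nat
  shows "(\<Oplus>\<^bsub>sds_space fs\<^esub> i \<in> {..l}. residue_classes fs (p i)) = residue_classes fs (\<Sum>i\<le>l. p i)"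
proof -
  interpret V: ring "sds_space fs"
    by (rule ring_sds_space)
  have closed: "residue_classes fs q \<in> carrier (sds_space fs)" for q
    using ring_hom_closed[OF residue_classes_ring_hom, of q] by simp
  show ?thesis
  proof (induction l)
    case (Suc l)
    then show ?case
      using ring_hom_add[OF residue_classes_ring_hom, of "p (Suc l)" "\<Sum>i\<le>l. p i" fs]
      by (simp add: V.finsum_Suc closed Pi_def add.commute)
  qed (simp add: closed V.finsum_0)
qed

lemma carrier_sds_space:
  assumes "v \<in> carrier (sds_space fs)"
  obtains us where "length us = length fs" "v = map2 residue_class fs us"
proof -
  have v: "length v = length fs" "\<And>i. i < length fs \<Longrightarrow> v ! i \<in> carrier (quotient_Zx (fs ! i))"
    using RDirProd_list_carrier_mem[OF assms[unfolded sds_space_def]] by simp_all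
  have "\<exists>u. v ! i = residue_class (fs ! i) u" if "i < length fs" for i
    using v(2)[OF that] by (auto simp: quotient_Zx_def FactRing_def A_RCOSETS_def' residue_class_def)
  then obtain u where u: "\<And>i. i < length fs \<Longrightarrow> v ! i = residue_class (fs ! i) (u i)"
    by metis
  show thesis
    by (rule that[of "map u [0..<length fs]"]) (auto simp: v(1) u intro!: nth_equalityI)
qed

text \<open>The first premise makes \<open>residue_classes fs\<close> surjective onto
  \<open>V\<close>, so \<open>v\<close> lifts to a polynomial \<open>p\<close>; the homomorphism
  carries an expansion of \<open>p\<close> modulo all entries of \<open>fs\<close> back to
  \<open>v\<close>.\<close>

lemma finite_expansion_property_sdsI:
  assumes crt: "\<And>us. length us = length fs \<Longrightarrow> \<exists>p. \<forall>i<length fs. fs ! i dvd us ! i - p"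
    and expansion: "\<And>p. \<exists>l c. (\<forall>i. c i \<in> R) \<and> (\<forall>f\<in>set fs. f dvd p - (\<Sum>i\<le>l. monom 1 i * c i))"
  shows "finite_expansion_property (sds_space fs) (sds_map fs) (sds_digits fs R)"
  unfolding finite_expansion_property_def
proof
  fix v assume "v \<in> carrier (sds_space fs)"
  then obtain us where us: "length us = length fs" "v = map2 residue_class fs us"
    by (rule carrier_sds_space)
  obtain p where p: "\<And>i. i < length fs \<Longrightarrow> fs ! i dvd us ! i - p"
    using crt[OF us(1)] by blast
  obtain l c where c: "\<And>i. c i \<in> R" "\<And>f. f \<in> set fs \<Longrightarrow> f dvd p - (\<Sum>i\<le>l. monom 1 i * c i)"
    using expansion[of p] by blast
  define d where "d i = residue_classes fs (c i)" for i :: nat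
  have "v = residue_classes fs p"
    using us(1) residue_class_eqI[OF p] by (simp add: us(2) residue_classes_def list_eq_iff_nth_eq)
  also have "\<dots> = residue_classes fs (\<Sum>i\<le>l. monom 1 i * c i)"
    using c(2) by (simp add: residue_classes_def residue_class_eqI)
  also have "\<dots> = (\<Oplus>\<^bsub>sds_space fs\<^esub> i \<in> {..l}. (sds_map fs ^^ i) (d i))"
    by (simp add: d_def funpow_sds_map_residue_classes finsum_residue_classes)
  finally have "v = (\<Oplus>\<^bsub>sds_space fs\<^esub> i \<in> {..l}. (sds_map fs ^^ i) (d i))" .
  moreover have "\<forall>i\<le>l. d i \<in> sds_digits fs R"
    using c(1) by (auto simp: d_def sds_digits_def residue_classes_def)
  ultimately show "\<exists>l d. (\<forall>i\<le>l. d i \<in> sds_digits fs R) \<and>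
      v = (\<Oplus>\<^bsub>sds_space fs\<^esub> i \<in> {..l}. (sds_map fs ^^ i) (d i))"
    by blast
qed

text \<open>Chinese remaindering: \<open>(s\<^sub>1 * g) * (s\<^sub>2 * h)\<close> is 1 modulo
  \<open>f\<close> and 0 modulo \<open>g\<close> and \<open>h\<close>; the other two products in
  \<open>p\<close> behave alike for \<open>g\<close> and \<open>h\<close>.\<close>

lemma ex_simultaneous_residue3:
  fixes f g h u v w :: "'a :: comm_ring_1"
  assumes fg: "r\<^sub>1 * f + s\<^sub>1 * g = 1" and fh: "r\<^sub>2 * f + s\<^sub>2 * h = 1" and gh: "r\<^sub>3 * g + s\<^sub>3 * h = 1"
  obtains p where "f dvd u - p" "g dvd v - p" "h dvd w - p"
proof
  define p where "p = u * (s\<^sub>1 * g) * (s\<^sub>2 * h) + v * (r\<^sub>1 * f) * (s\<^sub>3 * h) + w * (r\<^sub>2 * f) * (r\<^sub>3 * g)"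
  have a: "s\<^sub>1 * g = 1 - r\<^sub>1 * f" "s\<^sub>2 * h = 1 - r\<^sub>2 * f" "s\<^sub>3 * h = 1 - r\<^sub>3 * g"
    "r\<^sub>1 * f = 1 - s\<^sub>1 * g" "r\<^sub>2 * f = 1 - s\<^sub>2 * h" "r\<^sub>3 * g = 1 - s\<^sub>3 * h"
    using assms by (simp_all add: eq_diff_eq add.commute)
  have "u - p = f * (u * (r\<^sub>1 + r\<^sub>2 - r\<^sub>1 * f * r\<^sub>2) - v * r\<^sub>1 * (s\<^sub>3 * h) - w * r\<^sub>2 * (r\<^sub>3 * g))"
    unfolding p_def a(1,2) by (simp add: algebra_simps)
  then show "f dvd u - p" by simp
  have "v - p = g * (v * (s\<^sub>1 + r\<^sub>3 - s\<^sub>1 * g * r\<^sub>3) - u * s\<^sub>1 * (s\<^sub>2 * h) - w * (r\<^sub>2 * f) * r\<^sub>3)"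
    unfolding p_def a(3,4) by (simp add: algebra_simps)
  then show "g dvd v - p" by simp
  have "w - p = h * (w * (s\<^sub>2 + s\<^sub>3 - s\<^sub>2 * h * s\<^sub>3) - u * (s\<^sub>1 * g) * s\<^sub>2 - v * (r\<^sub>1 * f) * s\<^sub>3)"
    unfolding p_def a(5,6) by (simp add: algebra_simps)
  then show "h dvd w - p" by simp
qed

section \<open>The polynomials $f_a$, $g_a$, $h_a$\<close>

text \<open>Factors have leading coefficient 1 or -1, so constant factors are units and a linear
  factor has an integer root.\<close>

lemma irreducible_monic_quadratic:
  fixes p :: "int poly"
  assumes "degree p = 2" "lead_coeff p = 1" and no_root: "\<And>z. poly p z \<noteq> 0"
  shows "irreducible p"
proof (rule irreducibleI)
  show "p \<noteq> 0" using assms by auto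
  show "\<not> p dvd 1"
    using assms(1) by (auto simp: is_unit_poly_iff)
next
  fix u v assume uv: "p = u * v"
  then have "lead_coeff u * lead_coeff v = 1"
    using assms(2) by (simp add: lead_coeff_mult)
  then have lead: "\<bar>lead_coeff u\<bar> = 1" "\<bar>lead_coeff v\<bar> = 1"
    by (auto simp: zmult_eq_1_iff)
  have "u \<noteq> 0" "v \<noteq> 0"
    using uv assms(1) by auto
  then have deg: "degree u + degree v = 2"
    using uv assms(1) by (simp add: degree_mult_eq)
  have unit: "q dvd 1" if "degree q = 0" "\<bar>lead_coeff q\<bar> = 1" for q :: "int poly"
    using that by (auto simp: is_unit_const_poly_iff elim!: degree_eq_zeroE)
  have "degree u \<noteq> 1"
  proof
    assume "degree u = 1"
    then obtain b c where u: "u = [:b, c:]" "c \<noteq> 0"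
      by (metis degree1_coeffs)
    \<comment> \<open>Since \<open>c\<close> is its own inverse, the root \<open>- b / c\<close>
      equals \<open>- b * c\<close>.\<close>
    then have "poly u (- b * c) = 0"
      using lead(1) by (auto simp: abs_if split: if_splits)
    then show False
      using no_root uv by auto
  qed
  then have "degree u = 0 \<or> degree v = 0"
    using deg by linarith
  then show "u dvd 1 \<or> v dvd 1"
    using unit lead by blast
qed

lemma f_poly_altdef: "f_poly a = [:a * a + a - 1, - (2 * a + 1), 1:]"
  by (simp add: f_poly_def one_pCons algebra_simps)

lemma g_poly_altdef: "g_poly a = [:a * a - 2, - (2 * a), 1:]"
  by (simp add: g_poly_def f_poly_altdef one_pCons algebra_simps)

lemma h_poly_altdef: "h_poly a = [:a * a - 3, - (2 * a), 1:]"
  by (simp add: h_poly_def f_poly_altdef one_pCons algebra_simps numeral_poly)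

text \<open>Both numbers lie strictly between the squares 1 and 4. An integer root \<open>z\<close>
  of \<open>g_poly a\<close> or \<open>h_poly a\<close> would give \<open>(z - a)^2\<close> the
  value 2 or 3.\<close>

lemma square_neq_2_3:
  fixes z :: int
  shows "z * z \<noteq> 2" "z * z \<noteq> 3"
proof -
  have "z * z \<notin> {2, 3}"
  proof
    assume *: "z * z \<in> {2, 3}"
    have "\<bar>z\<bar> < 2"
    proof (rule ccontr)
      assume "\<not> \<bar>z\<bar> < 2"
      then have "2 * 2 \<le> \<bar>z\<bar> * \<bar>z\<bar>" by (intro mult_mono) auto
      then show False using * by auto
    qed
    then have "z \<in> {-1, 0, 1}" by auto
    then show False using * by auto
  qed
  then show "z * z \<noteq> 2" "z * z \<noteq> 3" by auto
qed

lemma irreducible_f_poly: "irreducible (f_poly a)"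
proof (rule irreducible_monic_quadratic)
  fix z
  \<comment> \<open>One of two consecutive integers is even.\<close>
  have "even ((z - a) * (z - a - 1))"
    by (cases "even z"; cases "even a") simp_all
  then have "(z - a) * (z - a - 1) \<noteq> 1"
    by (metis odd_one)
  then show "poly (f_poly a) z \<noteq> 0"
    by (simp add: f_poly_altdef algebra_simps)
qed (simp_all add: f_poly_altdef)

lemma irreducible_g_poly: "irreducible (g_poly a)"
proof (rule irreducible_monic_quadratic)
  fix z
  show "poly (g_poly a) z \<noteq> 0"
    using square_neq_2_3(1)[of "z - a"] by (simp add: g_poly_altdef algebra_simps)
qed (simp_all add: g_poly_altdef)

lemma irreducible_h_poly: "irreducible (h_poly a)"
proof (rule irreducible_monic_quadratic)
  fix z
  show "poly (h_poly a) z \<noteq> 0"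
    using square_neq_2_3(2)[of "z - a"] by (simp add: h_poly_altdef algebra_simps)
qed (simp_all add: h_poly_altdef)

text \<open>With \<open>y = x - a\<close> the cofactors here are \<open>-(y + 1)\<close> and
  \<open>y\<close>, and \<open>y + 2\<close> and \<open>-(y + 1)\<close> for \<open>f\<close> and
  \<open>h\<close>. These identities give coprimality, also of the values at 0, and the Chinese
  remaindering.\<close>

lemma bezout_fg: "- [:1 - a, 1:] * f_poly a + [:- a, 1:] * g_poly a = 1"
  by (simp add: f_poly_altdef g_poly_altdef one_pCons algebra_simps)

lemma bezout_fh: "[:2 - a, 1:] * f_poly a + (- [:1 - a, 1:]) * h_poly a = 1"
  by (simp add: f_poly_altdef h_poly_altdef one_pCons algebra_simps)

lemma bezout_gh: "1 * g_poly a + (- 1) * h_poly a = 1"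
  by (simp add: g_poly_altdef h_poly_altdef one_pCons)

lemma coprime_if_bezout:
  fixes x y :: "'a :: {comm_ring_1, algebraic_semidom}"
  assumes "r * x + s * y = 1"
  shows "coprime x y"
proof (rule coprimeI)
  fix c assume "c dvd x" "c dvd y"
  then have "c dvd r * x + s * y" by (intro dvd_add dvd_mult)
  then show "c dvd 1" by (simp add: assms)
qed

text \<open>In the variable \<open>t = -7 - a\<close> all coefficients, and their successive differences, are positive.\<close>

lemma fgh_product:
  assumes "a = - 7 - t"
  shows "f_poly a * g_poly a * h_poly a =
    [:88642 + 81488 * t + 30937 * t^2 + 6207 * t^3 + 694 * t^4 + 41 * t^5 + t^6,
      81488 + 61874 * t + 18621 * t^2 + 2776 * t^3 + 205 * t^4 + 6 * t^5,
      30937 + 18621 * t + 4164 * t^2 + 410 * t^3 + 15 * t^4,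
      6207 + 2776 * t + 410 * t^2 + 20 * t^3, 694 + 205 * t + 15 * t^2, 41 + 6 * t, 1:]"
  unfolding assms f_poly_altdef g_poly_altdef h_poly_altdef
  by (simp add: algebra_simps eval_nat_numeral)

text \<open>The bound on \<open>a\<close> is sharp for this: at \<open>a = -6\<close> the
  coefficient 35658 of \<open>x\<close> exceeds the constant coefficient 32538.\<close>

lemma antimono_coeff_product:
  assumes "a \<le> -7"
  shows "antimono (coeff (f_poly a * g_poly a * h_poly a))"
proof -
  define t where "t = - 7 - a"
  then have t: "a = - 7 - t" "0 \<le> t"
    using assms by simp_all
  have pw: "0 \<le> t^2" "0 \<le> t^3" "0 \<le> t^4" "0 \<le> t^5" "0 \<le> t^6"
    using t(2) by simp_all
  have "coeff (f_poly a * g_poly a * h_poly a) (Suc i) \<le> coeff (f_poly a * g_poly a * h_poly a) i" for i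
    using t(2) pw by (simp add: fgh_product[OF t(1)] coeff_pCons split: nat.split)
  then show ?thesis
    by (simp add: antimono_iff_le_Suc)
qed

theorem theorem4p8:
  fixes a :: int
  assumes "a \<le> -7"
  shows "Factorial_Ring.irreducible (f_poly a) \<and>
         Factorial_Ring.irreducible (g_poly a) \<and>
         Factorial_Ring.irreducible (h_poly a) \<and>
         coprime (f_poly a) (g_poly a) \<and>
         coprime (f_poly a) (h_poly a) \<and>
         coprime (g_poly a) (h_poly a) \<and>
         simultaneous_digit_system [f_poly a, g_poly a, h_poly a] (digit_polys a) \<and>
         finite_expansion_property
           (sds_space [f_poly a, g_poly a, h_poly a])
           (sds_map [f_poly a, g_poly a, h_poly a])
           (sds_digits [f_poly a, g_poly a, h_poly a] (digit_polys a))"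
proof -
  let ?f = "f_poly a" and ?g = "g_poly a" and ?h = "h_poly a"
  let ?F = "?f * ?g * ?h"
  let ?m = "poly ?f 0 * poly ?g 0 * poly ?h 0"
  \<comment> \<open>These bounds make the values of \<open>f\<close>, \<open>g\<close>,
    \<open>h\<close> at 0 at least 41, 47 and 46.\<close>
  have aa: "49 \<le> a * a + a + 7" "49 \<le> a * a"
  proof -
    have "7 * 7 \<le> (- a) * (- a)" "7 * 6 \<le> (- a) * (- a - 1)"
      using assms by (intro mult_mono; simp)+
    then show "49 \<le> a * a + a + 7" "49 \<le> a * a"
      by (simp_all add: algebra_simps)
  qed
  have large: "1 < poly ?f 0" "1 < poly ?g 0" "1 < poly ?h 0"
    using aa by (simp_all add: f_poly_altdef g_poly_altdef h_poly_altdef)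
  then have m: "0 < ?m"
    by simp
  have coeff_0: "coeff ?F 0 = ?m"
    by (simp add: poly_0_coeff_0[symmetric])
  note irred = irreducible_f_poly[of a] irreducible_g_poly[of a] irreducible_h_poly[of a]
  have cop: "coprime ?f ?g" "coprime ?f ?h" "coprime ?g ?h"
    using bezout_fg bezout_fh bezout_gh by (blast intro: coprime_if_bezout)+
  \<comment> \<open>Evaluation at 0 turns a Bezout identity of polynomials into one of
    integers.\<close>
  have eval: "r' * poly x 0 + s' * poly y 0 = 1"
    if "r * x + s * y = 1" "r' = poly r 0" "s' = poly s 0" for r s x y :: "int poly" and r' s'
    using arg_cong[OF that(1), of "\<lambda>p. poly p 0"] that(2,3) by simp
  have cop0: "coprime (poly ?f 0) (poly ?g 0)" "coprime (poly ?f 0) (poly ?h 0)"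
    "coprime (poly ?g 0) (poly ?h 0)"
    by (rule coprime_if_bezout[OF eval[OF bezout_fg refl refl]]
        coprime_if_bezout[OF eval[OF bezout_fh refl refl]]
        coprime_if_bezout[OF eval[OF bezout_gh refl refl]])+
  have digits: "digit_polys a = (\<lambda>c. [:c:]) ` {0..<?m}"
  proof -
    have "{0..\<bar>?m\<bar> - 1} = {0..<?m}"
      using m by auto
    then show ?thesis
      by (simp only: digit_polys_def)
  qed
  have "constant_coeffs_complete_residue_system (digit_polys a) ?m"
    unfolding constant_coeffs_complete_residue_system_def
  proof
    fix z
    show "\<exists>!c. c \<in> digit_polys a \<and> [coeff c 0 = z] (mod ?m)"
    proof (rule ex1I[of _ "[:z mod ?m:]"])
      show "[:z mod ?m:] \<in> digit_polys a \<and> [coeff [:z mod ?m:] 0 = z] (mod ?m)"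
        using m by (simp add: digits cong_def)
      show "c = [:z mod ?m:]" if "c \<in> digit_polys a \<and> [coeff c 0 = z] (mod ?m)" for c
        using that by (auto simp: digits cong_def)
    qed
  qed
  then have sds: "simultaneous_digit_system [?f, ?g, ?h] (digit_polys a)"
    using cop cop0 by (simp add: simultaneous_digit_system_def mult.assoc)
  have "finite_expansion_property (sds_space [?f, ?g, ?h]) (sds_map [?f, ?g, ?h])
      (sds_digits [?f, ?g, ?h] (digit_polys a))"
  proof (rule finite_expansion_property_sdsI)
    fix us :: "int poly list"
    assume "length us = length [?f, ?g, ?h]"
    then obtain u v w where us: "us = [u, v, w]"
      by (auto simp: length_Suc_conv)
    obtain p where "?f dvd u - p" "?g dvd v - p" "?h dvd w - p"
      using ex_simultaneous_residue3[OF bezout_fg bezout_fh bezout_gh] .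
    then show "\<exists>p. \<forall>i<length [?f, ?g, ?h]. [?f, ?g, ?h] ! i dvd us ! i - p"
      by (intro exI[of _ p]) (simp add: us less_Suc_eq nth_Cons')
  next
    fix p
    \<comment> \<open>Coprimality passes from the three irreducible factors to their
      product.\<close>
    have "coprime ?F (monom 1 k - 1)" if "0 < k" for k
      using irreducible_coprime_monom_minus_1 irred large that by (simp add: coprime_mult_left_iff)
    then have "\<exists>l c. (\<forall>i. c i \<in> {0..<coeff ?F 0}) \<and> ?F dvd p - (\<Sum>i\<le>l. monom (c i) i)"
      using m by (intro expansion_if_antimono_coeff antimono_coeff_product[OF assms]) (simp_all only: coeff_0)
    then obtain l c where c: "\<And>i. c i \<in> {0..<?m}" "?F dvd p - (\<Sum>i\<le>l. monom (c i) i)"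
      unfolding coeff_0 by blast
    have "?f dvd ?F" "?g dvd ?F" "?h dvd ?F"
      by simp_all
    then have "\<forall>f\<in>set [?f, ?g, ?h]. f dvd p - (\<Sum>i\<le>l. monom 1 i * [:c i:])"
      using c(2) by (auto simp: mult_monom simp flip: monom_0 intro: dvd_trans)
    moreover have "\<forall>i. [:c i:] \<in> digit_polys a"
      using c(1) by (simp add: digits)
    ultimately show "\<exists>l c. (\<forall>i. c i \<in> digit_polys a) \<and>
        (\<forall>f\<in>set [?f, ?g, ?h]. f dvd p - (\<Sum>i\<le>l. monom 1 i * c i))"
      by (intro exI[of _ l] exI[of _ "\<lambda>i. [:c i:]"]) simp
  qed
  with irred cop sds show ?thesis
    by simp
qed

end
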